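(* Let $\mu>(r-1)d/2$ and $\nu>(r-1)d/2$. The risk $R^{\mu,\nu}(\mathbf t)$ is a convex function of $\mathbf t=(t^{(1)},\dots,t^{(h)})$ on the domain $\left\{\mathbf t\in\mathbb R^h: t^{(i)}>-\mu-\frac{r_{(i)}-k^{(i)}}{2}d-1\ \text{for } i=1,\dots,h\right\}$, and attains its minimum at $\mathbf t=\mathbf t_R$.
   Context: Let $d\in\{1,2\}$ and let $r$ be a positive integer. $E_r$ is the real vector space of symmetric real $r\times r$ matrices (if $d=1$) or Hermitian complex $r\times r$ matrices (if $d=2$), $E_r^+\subset E_r$ the cone of positive definite matrices, and $n=\dim E_r=r+r(r-1)d/2$. $|x|$ is the determinant, $x^*$ the (conjugate) transpose, $\langle x\mid y\rangle=\mathrm{tr}(xy)$, and $dx$ is Lebesgue measure in the coordinates given by the diagonal entries and the real (and, if $d=2$, imaginary) parts of the entries above the diagonal. $\Xi=E_r^+$. For every positive integer $m$ and $\mu>(m-1)d/2$, $\Gamma_m(\mu)=\int_{E_m^+}|x|^{\mu-\frac{m-1}{2}d-1}e^{-\mathrm{tr}(x)}dx$ and $\psi_m(\mu)=\frac{d}{d\mu}\log\Gamma_m(\mu)$. For $\mu>(r-1)d/2$, $W_r(\mu,\xi)$, $\xi\in\Xi$, is the distribution on $E_r^+$ with density $p^\mu(x\mid\xi)=\frac{|x|^{\mu-n/r}}{\Gamma_r(\mu)}|\xi|^\mu e^{-\langle\xi\mid x\rangle}$. Partition and parameters. Let $h\ge2$ and let $\mathbf k=(k^{(1)},\dots,k^{(h)})$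 be positive integers with $\sum_i k^{(i)}=r$; put $r_{(i)}=k^{(1)}+\dots+k^{(i)}$ and $n_{(i)}=r_{(i)}+\frac{r_{(i)}(r_{(i)}-1)}{2}d$. For $\xi\in\Xi$ set $\zeta_{(h)}=\xi$ and, for $i=h,\dots,2$, write $\zeta_{(i)}\in E^+_{r_{(i)}}$ in blocks with respect to $r_{(i)}=r_{(i-1)}+k^{(i)}$ as $$\zeta_{(i)}=\begin{bmatrix}\xi_{(i-1)}&\xi^{(i)}_{1/2}\\ (\xi^{(i)}_{1/2})^*&\xi^{(i)}_0\end{bmatrix},\qquad \zeta_{(i-1)}:=\xi_{(i-1)}-\xi^{(i)}_{1/2}(\xi^{(i)}_0)^{-1}(\xi^{(i)}_{1/2})^*.$$ Put $\phi^{(1)}=\xi^{(1)}_0:=\zeta_{(1)}$ and $\phi^{(i)}=(\xi^{(i)}_{1/2},\xi^{(i)}_0)$ for $i\ge2$. The map $\xi\mapsto\phi=(\phi^{(1)},\dots,\phi^{(h)})$ is a bijection $\Xi\to\Phi$ with $d\xi=d\phi$, and $\xi$ and $\phi$ are identified. Priors. $\pi_{\mathbf t}(\phi)\,d\phi=\prod_{i=1}^h|\xi_0^{(i)}|^{t^{(i)}}d\phi^{(i)}$ (possibly improper). $\mathbf t_R=(t_R^{(1)},\dots,t_R^{(h)})$ with $t_R^{(i)}=-\left(\frac{2r_{(i)}-k^{(i)}-1}{2}d+1\right)$. Risk. $X\sim W_r(\mu,\xi)$ and $Y\sim W_r(\nu,\xi)$ are independent. The Bayesian predictive density is $\delta^{\mu,\nu}_{\mathbf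 t}(y\mid x)=\int_\Phi p^\nu(y\mid\phi)\pi^\mu_{\mathbf t}(\phi\mid x)d\phi$ with posterior $\pi^\mu_{\mathbf t}(\phi\mid x)\propto p^\mu(x\mid\phi)\pi_{\mathbf t}(\phi)$, and its risk is $R^{\mu,\nu}(\phi,\delta^{\mu,\nu}_{\mathbf t})=E_{X,Y}\left[\log\frac{p^\nu(Y\mid\xi)}{\delta^{\mu,\nu}_{\mathbf t}(Y\mid X)}\right]$. This risk does not depend on $\phi$; it equals $R^{\mu,\nu}(\mathbf t):=\sum_{i=1}^hR^{(i)\mu,\nu}(t^{(i)})$, where, for $t^{(i)}>-\mu-\frac{r_{(i)}-k^{(i)}}{2}d-1$, $$\begin{aligned}R^{(i)\mu,\nu}(t^{(i)}):={}&-\nu k^{(i)}-\log\Gamma_{k^{(i)}}\left(t^{(i)}+\mu+\nu+\tfrac{n_{(i)}}{r_{(i)}}\right)+\log\Gamma_{k^{(i)}}\left(t^{(i)}+\mu+\tfrac{n_{(i)}}{r_{(i)}}\right)\\&+\left(t^{(i)}+\mu+\nu+\tfrac{n_{(i)}}{r_{(i)}}\right)\psi_{r_{(i)}}(\mu+\nu)-\left(t^{(i)}+\mu+\tfrac{n_{(i)}}{r_{(i)}}\right)\psi_{r_{(i)}}(\mu)\\&-\left(t^{(i)}+\mu+\nu+\tfrac{n_{(i-1)}}{r_{(i-1)}}\right)\psi_{r_{(i-1)}}(\mu+\nu)+\left(t^{(i)}+\mu+\tfrac{n_{(i-1)}}{r_{(i-1)}}\right)\psi_{r_{(i-1)}}(\mu),\end{aligned}$$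 the last two terms being $0$ when $i=1$. *)

theory Defs
  imports
    "HOL-Analysis.Analysis"
    "Jordan_Normal_Form.Determinant"
    "Jordan_Normal_Form.Schur_Decomposition"
begin

text \<open>
  The real (\<open>d = 1\<close>) and complex (\<open>d = 2\<close>) cases are treated together: a real matrix is a
  complex matrix all of whose entries lie in \<^term>\<open>\<real> :: complex set\<close>. For such matrices the
  adjoint is the transpose. Every \<open>d \<noteq> 1\<close> is read as the complex case.
\<close>

definition scalars :: "nat \<Rightarrow> complex set" where
  "scalars d = (if d = 1 then \<real> else UNIV)"

definition herm_space :: "nat \<Rightarrow> nat \<Rightarrow> complex mat set" where
  "herm_space d m =
     {A \<in> carrier_mat m m. elements_mat A \<subseteq> scalars d \<and> mat_adjoint A = A}"

text \<open>For \<open>A\<close> in \<^term>\<open>herm_space d m\<close> the form \<open>v\<^sup>* A v\<close> is real-valued, so \<^const>\<open>Re\<close> loses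
  nothing; the same applies to determinant and trace below.\<close>

definition pd_cone :: "nat \<Rightarrow> nat \<Rightarrow> complex mat set" where
  "pd_cone d m =
     {A \<in> herm_space d m.
        \<forall>v \<in> carrier_vec m. vec_set v \<subseteq> scalars d \<longrightarrow> v \<noteq> 0\<^sub>v m \<longrightarrow> 0 < Re ((A *\<^sub>v v) \<bullet>c v)}"

definition mat_det :: "complex mat \<Rightarrow> real" where
  "mat_det A = Re (Determinant.det A)"

definition mat_tr :: "complex mat \<Rightarrow> real" where
  "mat_tr A = Re (\<Sum>i<dim_row A. A $$ (i, i))"

text \<open>
  Real coordinates on \<^term>\<open>herm_space d m\<close>: for \<open>i \<le> j\<close> the coordinate at \<open>(i, j)\<close> is the real part
  of the entry \<open>(i, j)\<close>; if \<open>d = 2\<close>, then for \<open>i < j\<close> the coordinate at the transposed index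
  \<open>(j, i)\<close> is the imaginary part of the entry \<open>(i, j)\<close>.
\<close>

definition coord_index :: "nat \<Rightarrow> nat \<Rightarrow> (nat \<times> nat) set" where
  "coord_index d m = {(i, j). i < m \<and> j < m \<and> (i \<le> j \<or> d \<noteq> 1)}"

definition coord_mat :: "nat \<Rightarrow> nat \<Rightarrow> (nat \<times> nat \<Rightarrow> real) \<Rightarrow> complex mat" where
  "coord_mat d m w = Matrix.mat m m (\<lambda>(i, j).
     if i = j then of_real (w (i, i))
     else if i < j then Complex (w (i, j)) (if d = 1 then 0 else w (j, i))
     else Complex (w (j, i)) (if d = 1 then 0 else - w (i, j)))"

definition coord_lebesgue :: "nat \<Rightarrow> nat \<Rightarrow> (nat \<times> nat \<Rightarrow> real) measure" where
  "coord_lebesgue d m = (\<Pi>\<^sub>M p \<in> coord_index d m. lborel)"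

definition cone_Gamma :: "nat \<Rightarrow> nat \<Rightarrow> real \<Rightarrow> real" where
  "cone_Gamma d m \<mu> =
     (LINT w : {w. coord_mat d m w \<in> pd_cone d m} | coord_lebesgue d m.
        mat_det (coord_mat d m w) powr (\<mu> - (real m - 1) / 2 * real d - 1)
          * exp (- mat_tr (coord_mat d m w)))"

definition cone_psi :: "nat \<Rightarrow> nat \<Rightarrow> real \<Rightarrow> real" where
  "cone_psi d m \<mu> = deriv (\<lambda>s. ln (cone_Gamma d m s)) \<mu>"

text \<open>
  A partition of \<open>r\<close> into \<open>h\<close> parts is a family \<open>k\<close> indexed by a finite linearly ordered type
  with \<open>h\<close> elements, which plays the role of \<open>{1, \<dots>, h}\<close>; this makes the parameter space \<open>\<real>\<^sup>h\<close>
  the type \<^typ>\<open>real ^ 'h\<close>. For the index \<open>i\<close>, \<open>r_upto k i\<close> and \<open>r_below k i\<close> stand for \<open>r\<^sub>(\<^sub>i\<^sub>)\<close> and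
  \<open>r\<^sub>(\<^sub>i\<^sub>-\<^sub>1\<^sub>)\<close>.
\<close>

definition r_upto :: "('h::{finite,linorder} \<Rightarrow> nat) \<Rightarrow> 'h \<Rightarrow> nat" where
  "r_upto k i = (\<Sum>j\<in>{..i}. k j)"

definition r_below :: "('h::{finite,linorder} \<Rightarrow> nat) \<Rightarrow> 'h \<Rightarrow> nat" where
  "r_below k i = (\<Sum>j\<in>{..<i}. k j)"

definition herm_dim :: "nat \<Rightarrow> nat \<Rightarrow> real" where
  "herm_dim d m = real m + real m * (real m - 1) / 2 * real d"

text \<open>
  For the prior \<open>\<Prod>i. |\<xi>\<^sub>0\<^sup>(\<^sup>i\<^sup>)| powr t\<^sup>(\<^sup>i\<^sup>)\<close> the Kullback-Leibler risk of the Bayesian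
  predictive density does not depend on \<open>\<xi>\<close>; it is the function \<open>risk\<close> of \<open>t\<close> given here in
  closed form, as a sum over the blocks. The terms in \<open>r\<^sub>(\<^sub>i\<^sub>-\<^sub>1\<^sub>)\<close> are absent for the first block.
\<close>

definition risk_part ::
  "nat \<Rightarrow> ('h::{finite,linorder} \<Rightarrow> nat) \<Rightarrow> real \<Rightarrow> real \<Rightarrow> 'h \<Rightarrow> real \<Rightarrow> real" where
  "risk_part d k \<mu> \<nu> i s =
     (let r = r_upto k i; q = r_below k i;
          a = herm_dim d r / real r; b = herm_dim d q / real q
      in - \<nu> * real (k i)
         - ln (cone_Gamma d (k i) (s + \<mu> + \<nu> + a))
         + ln (cone_Gamma d (k i) (s + \<mu> + a))
         + (s + \<mu> + \<nu> + a) * cone_psi d r (\<mu> + \<nu>)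
         - (s + \<mu> + a) * cone_psi d r \<mu>
         + (if {..<i} = {} then 0
            else - (s + \<mu> + \<nu> + b) * cone_psi d q (\<mu> + \<nu>) + (s + \<mu> + b) * cone_psi d q \<mu>))"

definition risk ::
  "nat \<Rightarrow> ('h::{finite,linorder} \<Rightarrow> nat) \<Rightarrow> real \<Rightarrow> real \<Rightarrow> real ^ ('h::{finite,linorder}) \<Rightarrow> real" where
  "risk d k \<mu> \<nu> t = (\<Sum>i\<in>UNIV. risk_part d k \<mu> \<nu> i (t $ i))"

definition risk_domain ::
  "nat \<Rightarrow> ('h::{finite,linorder} \<Rightarrow> nat) \<Rightarrow> real \<Rightarrow> (real ^ ('h::{finite,linorder})) set" where
  "risk_domain d k \<mu> =
     {t. \<forall>i. t $ i > - \<mu> - (real (r_upto k i) - real (k i)) / 2 * real d - 1}"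

definition t_R :: "nat \<Rightarrow> ('h::{finite,linorder} \<Rightarrow> nat) \<Rightarrow> real ^ ('h::{finite,linorder})" where
  "t_R d k = (\<chi> i. - ((2 * real (r_upto k i) - real (k i) - 1) / 2 * real d + 1))"

end

theory Submission
  imports Defs "HOL-Probability.Distributions"
begin

text \<open>
  The risk is a sum of functions of one coordinate each, so convexity and minimality are questions
  about a single block \<open>i\<close>. Write \<open>r\<close>, \<open>q\<close> for the partial sums up to and below \<open>i\<close>, \<open>m = r - q\<close> for the
  block size, and \<open>x = s + \<mu> + n/r\<close>, where \<open>n\<close> is the dimension belonging to \<open>r\<close>. Up to terms affine in \<open>s\<close>, the
  contribution of the block is \<open>ln \<Gamma>\<^sub>m(x) - ln \<Gamma>\<^sub>m(x + \<nu>)\<close>, with derivative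
    \<open>\<psi>\<^sub>m(x) - \<psi>\<^sub>m(x + \<nu>) + (\<psi>\<^sub>r - \<psi>\<^sub>q)(\<mu> + \<nu>) - (\<psi>\<^sub>r - \<psi>\<^sub>q)(\<mu>)\<close>.
  Everything follows from the product formula
    \<open>\<Gamma>\<^sub>m(\<mu>) = const * (\<Prod>j<m. \<Gamma>(\<mu> - j d/2))\<close>   (\<open>cone_Gamma_eq_prod_Gamma\<close>),
  which turns \<open>\<psi>\<^sub>m\<close> into a sum of shifted digamma functions. First, the trigamma function decreases on
  the positive axis, so \<open>\<psi>\<^sub>m(x) - \<psi>\<^sub>m(x + \<nu>)\<close> increases and the block is convex. Secondly,
  \<open>\<psi>\<^sub>r - \<psi>\<^sub>q\<close> is \<open>\<psi>\<^sub>m\<close> shifted by \<open>q d/2\<close> (\<open>psi_sum_add\<close>), so the derivative vanishes where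
  \<open>x = \<mu> - q d/2\<close>, and solving for \<open>s\<close> gives exactly the coordinate of \<open>t_R\<close>.

  The product formula is proved by induction on the size of the matrix. Split off the last row and
  column, with diagonal entry \<open>c\<close> and off-diagonal column \<open>b\<close>, and replace the leading block \<open>B\<close> by the
  Schur complement \<open>B - b b\<^sup>*/c\<close>. Positivity, determinant and trace all decouple
  (\<open>cone_weight_Suc\<close>), and for fixed \<open>b\<close>, \<open>c\<close> the substitution is a mere translation of
  the coordinates of \<open>B\<close>, under which Lebesgue measure is invariant. What remains is a product of
  one-dimensional Gaussian integrals over \<open>b\<close> and an Euler integral over \<open>c\<close>.
\<close>

section \<open>Schur complements of coordinate matrices\<close>

definition quad_form :: "nat \<Rightarrow> (nat \<Rightarrow> nat \<Rightarrow> complex) \<Rightarrow> (nat \<Rightarrow> complex) \<Rightarrow> complex" where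
  "quad_form m a u = (\<Sum>i<m. \<Sum>j<m. a i j * u j * cnj (u i))"

text \<open>Completing the square in the last variable: what is left over is the quadratic form of the
  Schur complement of the last diagonal entry.\<close>

lemma quad_form_complete_square:
  assumes herm: "\<And>j. j < m \<Longrightarrow> a m j = cnj (a j m)"
    and c: "a m m = of_real c" "c \<noteq> 0"
  shows "quad_form (Suc m) a u =
    quad_form m (\<lambda>i j. a i j - a i m * cnj (a j m) / of_real c) u
      + of_real (c * (cmod (u m + (\<Sum>j<m. cnj (a j m) * u j) / of_real c))\<^sup>2)"
proof -
  define S where "S = (\<Sum>j<m. cnj (a j m) * u j)"
  have col: "(\<Sum>i<m. a i m * u m * cnj (u i)) = u m * cnj S"
    by (simp add: S_def sum_distrib_left sum_distrib_right mult_ac)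
  have row: "(\<Sum>j<m. a m j * u j * cnj (u m)) = S * cnj (u m)"
    by (simp add: S_def sum_distrib_right herm)
  have "(\<Sum>i<m. \<Sum>j<m. (a i m * cnj (a j m) / of_real c) * u j * cnj (u i)) = cnj S * S / of_real c"
    unfolding S_def cnj_sum sum_product sum_divide_distrib by (simp add: mult_ac)
  hence schur: "quad_form m (\<lambda>i j. a i j - a i m * cnj (a j m) / of_real c) u
      = quad_form m a u - cnj S * S / of_real c"
    by (simp add: quad_form_def left_diff_distrib sum_subtractf)
  have "quad_form (Suc m) a u =
      quad_form m a u + u m * cnj S + (S * cnj (u m) + of_real c * u m * cnj (u m))"
    by (simp add: quad_form_def sum.distrib col row c add_ac)
  also have "\<dots> = quad_form m a u - cnj S * S / of_real c
      + of_real c * ((u m + S / of_real c) * cnj (u m + S / of_real c))"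
    using c(2) by (simp add: field_simps)
  finally show ?thesis
    unfolding schur S_def[symmetric] by (simp only: of_real_mult complex_norm_square)
qed

lemma coord_mat_carrier [simp]: "coord_mat d m w \<in> carrier_mat m m"
  by (simp add: coord_mat_def)

lemma dim_coord_mat [simp]: "dim_row (coord_mat d m w) = m" "dim_col (coord_mat d m w) = m"
  by (simp_all add: coord_mat_def)

text \<open>The entries are treated as a function on all index pairs, independent of the matrix size, so that
  passing from size \<open>m + 1\<close> to its leading block of size \<open>m\<close> does not change them.\<close>

definition entry :: "nat \<Rightarrow> (nat \<times> nat \<Rightarrow> real) \<Rightarrow> nat \<Rightarrow> nat \<Rightarrow> complex" where
  "entry d w i j =
     (if i = j then of_real (w (i, i))
      else if i < j then Complex (w (i, j)) (if d = 1 then 0 else w (j, i))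
      else Complex (w (j, i)) (if d = 1 then 0 else - w (i, j)))"

lemma coord_mat_entry [simp]:
  "i < m \<Longrightarrow> j < m \<Longrightarrow> coord_mat d m w $$ (i, j) = entry d w i j"
  by (simp add: coord_mat_def entry_def)

lemma cnj_entry: "cnj (entry d w i j) = entry d w j i"
  by (auto simp: entry_def complex_eq_iff)

lemma entry_diag [simp]: "entry d w i i = of_real (w (i, i))"
  by (simp add: entry_def)

lemma entry_scalars: "entry d w i j \<in> scalars d"
  by (auto simp: entry_def scalars_def complex_is_Real_iff)

lemma scalars_closed:
  "0 \<in> scalars d" "1 \<in> scalars d" "x \<in> scalars d \<Longrightarrow> y \<in> scalars d \<Longrightarrow> x * y \<in> scalars d"
  "x \<in> scalars d \<Longrightarrow> - x \<in> scalars d"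
  "x \<in> scalars d \<Longrightarrow> x / of_real c \<in> scalars d"
  "(\<And>i. i \<in> I \<Longrightarrow> f i \<in> scalars d) \<Longrightarrow> sum f I \<in> scalars d"
  by (auto simp: scalars_def split: if_splits)

lemma coord_mat_cong:
  assumes "\<And>p. p \<in> coord_index d m \<Longrightarrow> w p = w' p"
  shows "coord_mat d m w = coord_mat d m w'"
  using assms by (intro eq_matI) (auto simp: coord_index_def entry_def)

lemma coord_mat_herm: "coord_mat d m w \<in> herm_space d m"
proof -
  have "mat_adjoint (coord_mat d m w) = coord_mat d m w"
    by (rule eq_matI) (auto simp: mat_adjoint_def mat_of_rows_index cnj_entry)
  moreover have "elements_mat (coord_mat d m w) \<subseteq> scalars d"
    by (auto dest!: elements_matD simp: entry_scalars)
  ultimately show ?thesis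
    by (simp add: herm_space_def)
qed

lemma coord_mat_quad_form:
  assumes v: "v \<in> carrier_vec m"
  shows "(coord_mat d m w *\<^sub>v v) \<bullet>c v = quad_form m (entry d w) (\<lambda>i. vec_index v i)"
  using v
  by (auto simp: quad_form_def scalar_prod_def atLeast0LessThan sum_distrib_right
      intro!: sum.cong)

text \<open>Coordinate matrices are Hermitian by construction, so membership in the cone only tests the
  quadratic form; vectors are replaced by functions on indices, which are easier to extend by a last
  component.\<close>

lemma coord_mat_in_pd_cone_iff:
  "coord_mat d m w \<in> pd_cone d m \<longleftrightarrow>
     (\<forall>u. (\<forall>i<m. u i \<in> scalars d) \<longrightarrow> (\<exists>i<m. u i \<noteq> 0) \<longrightarrow> 0 < Re (quad_form m (entry d w) u))"
  (is "?L \<longleftrightarrow> ?R")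
proof
  assume L: ?L
  show ?R
  proof (intro allI impI)
    fix u :: "nat \<Rightarrow> complex"
    assume u: "\<forall>i<m. u i \<in> scalars d" "\<exists>i<m. u i \<noteq> 0"
    let ?v = "Matrix.vec m u"
    have "vec_set ?v \<subseteq> scalars d" "?v \<noteq> 0\<^sub>v m"
      using u by (auto simp: vec_set_def vec_eq_iff)
    hence "0 < Re ((coord_mat d m w *\<^sub>v ?v) \<bullet>c ?v)"
      using L by (simp add: pd_cone_def)
    moreover have "quad_form m (entry d w) (\<lambda>i. vec_index ?v i) = quad_form m (entry d w) u"
      by (simp add: quad_form_def)
    ultimately show "0 < Re (quad_form m (entry d w) u)"
      by (simp add: coord_mat_quad_form)
  qed
next
  assume R: ?R
  have "0 < Re ((coord_mat d m w *\<^sub>v v) \<bullet>c v)"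
    if v: "v \<in> carrier_vec m" "vec_set v \<subseteq> scalars d" "v \<noteq> 0\<^sub>v m" for v
  proof -
    have "\<forall>i<m. vec_index v i \<in> scalars d" "\<exists>i<m. vec_index v i \<noteq> 0"
      using v by (auto simp: vec_set_def vec_eq_iff)
    thus ?thesis using R v(1) by (simp add: coord_mat_quad_form)
  qed
  thus ?L by (simp add: pd_cone_def coord_mat_herm)
qed

text \<open>The real coordinates of the rank-one matrix \<open>b b\<^sup>*/c\<close>, where \<open>b\<close> is the last column above the
  diagonal and \<open>c\<close> is the last diagonal entry; as in \<^const>\<open>coord_mat\<close>, imaginary parts are stored below the diagonal.
  Subtracting it yields the Schur complement.\<close>

definition schur_shift :: "nat \<Rightarrow> nat \<Rightarrow> (nat \<times> nat \<Rightarrow> real) \<Rightarrow> nat \<times> nat \<Rightarrow> real" where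
  "schur_shift d m w = (\<lambda>(i, j).
     (if i \<le> j then Re (entry d w i m * cnj (entry d w j m))
      else Im (entry d w j m * cnj (entry d w i m))) / w (m, m))"

lemma entry_schur_complement:
  assumes "i < m" "j < m"
  shows "entry d (\<lambda>p. w p - schur_shift d m w p) i j
    = entry d w i j - entry d w i m * cnj (entry d w j m) / of_real (w (m, m))"
proof -
  have [simp]: "Re (z / of_real c) = Re z / c" "Im (z / of_real c) = Im z / c" for z and c :: real
    by simp_all
  show ?thesis
    using assms
    by (cases i j rule: linorder_cases)
      (auto simp: entry_def schur_shift_def complex_eq_iff mult_ac diff_divide_distrib add_divide_distrib)
qed

text \<open>By \<open>quad_form_complete_square\<close> the form is a sum of the form of the Schur complement and a
  square weighted by \<open>c\<close>. Each summand can be isolated: the last unit vector isolates \<open>c\<close>, and choosing the last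
  component so that the square vanishes isolates the Schur complement.\<close>

lemma pd_cone_Suc_iff:
  "coord_mat d (Suc m) w \<in> pd_cone d (Suc m) \<longleftrightarrow>
     0 < w (m, m) \<and> coord_mat d m (\<lambda>p. w p - schur_shift d m w p) \<in> pd_cone d m"
proof -
  let ?c = "w (m, m)" and ?a = "entry d w" and ?w' = "\<lambda>p. w p - schur_shift d m w p"
  define S where "S u = (\<Sum>j<m. cnj (?a j m) * u j)" for u
  have square: "Re (quad_form (Suc m) ?a u) =
      Re (quad_form m (entry d ?w') u) + ?c * (cmod (u m + S u / of_real ?c))\<^sup>2" if "?c \<noteq> 0" for u
  proof -
    have "quad_form m (entry d ?w') u =
        quad_form m (\<lambda>i j. ?a i j - ?a i m * cnj (?a j m) / of_real ?c) u"
      by (simp add: quad_form_def entry_schur_complement)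
    thus ?thesis
      using that by (subst quad_form_complete_square[where c = ?c]) (auto simp: cnj_entry S_def)
  qed
  show ?thesis
  proof
    assume pd: "coord_mat d (Suc m) w \<in> pd_cone d (Suc m)"
    have "quad_form (Suc m) ?a (\<lambda>i. if i = m then 1 else 0) = of_real ?c"
      by (simp add: quad_form_def)
    moreover have "0 < Re (quad_form (Suc m) ?a (\<lambda>i. if i = m then 1 else 0))"
      using pd unfolding coord_mat_in_pd_cone_iff
      by (elim allE[of _ "\<lambda>i. if i = m then 1 else 0"]) (auto simp: scalars_closed)
    ultimately have c: "0 < ?c" by simp
    have "0 < Re (quad_form m (entry d ?w') u)"
      if u: "\<forall>i<m. u i \<in> scalars d" "\<exists>i<m. u i \<noteq> 0" for u
    proof -
      \<comment> \<open>this last coordinate makes the square vanish\<close>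
      define u' where "u' = u(m := - (S u / of_real ?c))"
      have S: "S u' = S u" and q: "quad_form m (entry d ?w') u' = quad_form m (entry d ?w') u"
        by (simp_all add: S_def u'_def quad_form_def)
      have "S u \<in> scalars d"
        using u unfolding S_def by (auto intro!: scalars_closed simp: cnj_entry entry_scalars)
      hence "\<forall>i<Suc m. u' i \<in> scalars d" "\<exists>i<Suc m. u' i \<noteq> 0"
        using u by (auto simp: u'_def less_Suc_eq intro!: scalars_closed)
      hence "0 < Re (quad_form (Suc m) ?a u')"
        using pd unfolding coord_mat_in_pd_cone_iff by blast
      thus ?thesis
        using c by (simp add: square q S) (simp add: u'_def)
    qed
    thus "0 < ?c \<and> coord_mat d m ?w' \<in> pd_cone d m"
      using c unfolding coord_mat_in_pd_cone_iff by blast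
  next
    assume asm: "0 < ?c \<and> coord_mat d m ?w' \<in> pd_cone d m"
    hence c: "0 < ?c" by simp
    have "0 < Re (quad_form (Suc m) ?a u)"
      if u: "\<forall>i<Suc m. u i \<in> scalars d" "\<exists>i<Suc m. u i \<noteq> 0" for u
    proof (cases "\<exists>i<m. u i \<noteq> 0")
      case True
      hence "0 < Re (quad_form m (entry d ?w') u)"
        using asm u(1) unfolding coord_mat_in_pd_cone_iff by auto
      thus ?thesis using c by (simp add: square add_pos_nonneg)
    next
      case False
      hence "S u = 0" "quad_form m (entry d ?w') u = 0" "u m \<noteq> 0"
        using u(2) by (auto simp: S_def quad_form_def less_Suc_eq)
      thus ?thesis using c by (simp add: square)
    qed
    thus "coord_mat d (Suc m) w \<in> pd_cone d (Suc m)"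
      unfolding coord_mat_in_pd_cone_iff by blast
  qed
qed

text \<open>Block elimination: the matrix is a unipotent upper triangular block matrix times a lower
  triangular one whose diagonal blocks are the Schur complement and \<open>c\<close>.\<close>

lemma det_Suc_schur:
  assumes c: "w (m, m) \<noteq> 0"
  shows "Determinant.det (coord_mat d (Suc m) w) =
    of_real (w (m, m)) * Determinant.det (coord_mat d m (\<lambda>p. w p - schur_shift d m w p))"
proof -
  let ?c = "of_real (w (m, m)) :: complex" and ?B = "coord_mat d m (\<lambda>p. w p - schur_shift d m w p)"
  let ?U = "four_block_mat (1\<^sub>m m) (Matrix.mat m 1 (\<lambda>(i, j). entry d w i m / ?c)) (0\<^sub>m 1 m) (1\<^sub>m 1)"
  let ?L = "four_block_mat ?B (0\<^sub>m m 1) (Matrix.mat 1 m (\<lambda>(i, j). entry d w m j)) (Matrix.mat 1 1 (\<lambda>_. ?c))"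
  have "coord_mat d (Suc m) w = ?U * ?L"
    using c
    by (subst mult_four_block_mat[where ?nr1.0 = m and ?n1.0 = m and ?n2.0 = 1
          and ?nr2.0 = 1 and ?nc1.0 = m and ?nc2.0 = 1])
      (auto simp: scalar_prod_def less_Suc_eq entry_schur_complement cnj_entry intro!: eq_matI)
  moreover have "Determinant.det ?U = 1"
    by (subst det_four_block_mat_lower_left_zero[where n = m and m = 1]) auto
  moreover have "Determinant.det ?L = Determinant.det ?B * ?c"
    by (subst det_four_block_mat_upper_right_zero[where n = m and m = 1]) (auto simp: det_single)
  ultimately show ?thesis
    by (subst \<open>coord_mat d (Suc m) w = ?U * ?L\<close>, subst det_mult[where n = "Suc m"]) auto
qed

lemma mat_tr_coord_mat: "mat_tr (coord_mat d m w) = (\<Sum>i<m. w (i, i))"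
  by (simp add: mat_tr_def)

section \<open>The gamma integral of the cone\<close>

interpretation lborel_prod: product_sigma_finite "\<lambda>_. lborel :: real measure"
  by standard

lemma finite_coord_index: "finite (coord_index d m)"
  by (rule finite_subset[of _ "{..<m} \<times> {..<m}"]) (auto simp: coord_index_def)

text \<open>A product measure is determined by its values on boxes, and translating a box translates each
  side, which one-dimensional Lebesgue measure does not notice.\<close>

lemma nn_integral_PiM_lborel_translate:
  fixes a :: "'i \<Rightarrow> real"
  assumes I: "finite I" and f: "f \<in> borel_measurable (PiM I (\<lambda>_. lborel))"
  shows "(\<integral>\<^sup>+w. f (\<lambda>p\<in>I. w p + a p) \<partial>PiM I (\<lambda>_. lborel)) = (\<integral>\<^sup>+w. f w \<partial>PiM I (\<lambda>_. lborel))"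
proof -
  let ?M = "PiM I (\<lambda>_. lborel :: real measure)" and ?T = "\<lambda>w. \<lambda>p\<in>I. w p + a p"
  have T [measurable]: "?T \<in> measurable ?M ?M"
    by measurable
  have "distr ?M ?M ?T = ?M"
  proof (rule lborel_prod.PiM_eqI[OF I])
    fix A :: "'i \<Rightarrow> real set"
    assume A: "\<And>i. i \<in> I \<Longrightarrow> A i \<in> sets lborel"
    have A': "(\<lambda>x. x + a i) -` A i \<in> sets lborel" if "i \<in> I" for i
      using measurable_sets[of "\<lambda>x. x + a i" lborel lborel "A i"] A[OF that] by simp
    have "emeasure (distr ?M ?M ?T) (Pi\<^sub>E I A) = emeasure ?M (?T -` Pi\<^sub>E I A \<inter> space ?M)"
      using A I by (intro emeasure_distr T sets_PiM_I_finite) auto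
    also have "?T -` Pi\<^sub>E I A \<inter> space ?M = Pi\<^sub>E I (\<lambda>i. (\<lambda>x. x + a i) -` A i)"
      by (auto simp: space_PiM PiE_def Pi_def)
    also have "emeasure ?M \<dots> = (\<Prod>i\<in>I. emeasure lborel ((\<lambda>x. x + a i) -` A i))"
      using I A' by (intro lborel_prod.emeasure_PiM)
    also have "\<dots> = (\<Prod>i\<in>I. emeasure lborel (A i))"
    proof (rule prod.cong[OF refl])
      fix i assume "i \<in> I"
      hence "emeasure (distr lborel borel ((+) (a i))) (A i) = emeasure lborel ((+) (a i) -` A i)"
        using A by (subst emeasure_distr) auto
      thus "emeasure lborel ((\<lambda>x. x + a i) -` A i) = emeasure lborel (A i)"
        by (simp add: lborel_distr_plus add.commute[of _ "a i"])
    qed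
    finally show "emeasure (distr ?M ?M ?T) (Pi\<^sub>E I A) = (\<Prod>i\<in>I. emeasure lborel (A i))" .
  qed simp
  hence "(\<integral>\<^sup>+w. f w \<partial>?M) = (\<integral>\<^sup>+w. f w \<partial>distr ?M ?M ?T)"
    by simp
  also have "\<dots> = (\<integral>\<^sup>+w. f (?T w) \<partial>?M)"
    using f by (intro nn_integral_distr T) simp
  finally show ?thesis by simp
qed

text \<open>This is the normalisation of the normal density with variance \<open>c/2\<close>.\<close>

lemma nn_integral_gaussian:
  fixes c :: real
  assumes c: "0 < c"
  shows "(\<integral>\<^sup>+x. ennreal (exp (- x\<^sup>2 / c)) \<partial>lborel) = ennreal (sqrt (pi * c))"
proof -
  let ?\<sigma> = "sqrt (c / 2)"
  have "(\<integral>\<^sup>+x. ennreal (normal_density 0 ?\<sigma> x) \<partial>lborel) = 1"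
    using c by (subst nn_integral_eq_integral) (auto simp: integrable_normal_density integral_normal_density)
  moreover have "ennreal (exp (- x\<^sup>2 / c)) = ennreal (sqrt (pi * c)) * ennreal (normal_density 0 ?\<sigma> x)" for x
    using c by (simp add: normal_density_def ennreal_mult[symmetric])
  ultimately show ?thesis
    by (simp add: nn_integral_cmult)
qed

text \<open>The integrand of \<^const>\<open>cone_Gamma\<close> with the exponent \<open>s\<close> of the determinant as parameter. Keeping
  \<open>s\<close> rather than \<open>\<mu>\<close> is what makes the recursion on \<open>m\<close> work: splitting off a row leaves \<open>s\<close> unchanged,
  whereas \<open>\<mu>\<close> would have to be shifted.\<close>

definition cone_weight :: "nat \<Rightarrow> nat \<Rightarrow> real \<Rightarrow> (nat \<times> nat \<Rightarrow> real) \<Rightarrow> real" where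
  "cone_weight d m s w =
     indicator {w. coord_mat d m w \<in> pd_cone d m} w
       * (mat_det (coord_mat d m w) powr s * exp (- mat_tr (coord_mat d m w)))"

lemma cone_weight_nonneg: "0 \<le> cone_weight d m s w"
  by (simp add: cone_weight_def)

lemma cone_weight_0: "cone_weight d 0 s w = 1"
proof -
  have "coord_mat d 0 w \<in> pd_cone d 0"
    by (simp add: coord_mat_in_pd_cone_iff)
  moreover have "Determinant.det (coord_mat d 0 w) = 1"
    by (rule det_dim_zero) simp
  ultimately show ?thesis
    by (simp add: cone_weight_def mat_det_def mat_tr_coord_mat)
qed

lemma cone_weight_cong:
  "(\<And>p. p \<in> coord_index d m \<Longrightarrow> w p = w' p) \<Longrightarrow> cone_weight d m s w = cone_weight d m s w'"
  by (simp add: cone_weight_def indicator_def coord_mat_cong[of d m w w'])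

text \<open>The coordinates of the last column of a matrix of size \<open>m + 1\<close> above the diagonal. In the complex
  case the transposed indices belong to them as well, because they hold the imaginary parts.\<close>

definition border_index :: "nat \<Rightarrow> nat \<Rightarrow> (nat \<times> nat) set" where
  "border_index d m = {(i, j). (i < m \<and> j = m) \<or> (d \<noteq> 1 \<and> i = m \<and> j < m)}"

lemma border_index_alt:
  "border_index d m = (\<lambda>i. (i, m)) ` {..<m} \<union> (if d = 1 then {} else (\<lambda>i. (m, i)) ` {..<m})"
  by (auto simp: border_index_def)

lemma finite_border_index: "finite (border_index d m)"
  by (simp add: border_index_alt)

lemma card_border_index: "d \<in> {1, 2} \<Longrightarrow> card (border_index d m) = m * d"
proof -
  assume d: "d \<in> {1, 2}"
  have "card ((\<lambda>i. (i, m)) ` {..<m}) = m" "card ((\<lambda>i. (m, i)) ` {..<m}) = m"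
    by (simp_all add: card_image inj_on_def)
  moreover have "(\<lambda>i. (i, m)) ` {..<m} \<inter> (\<lambda>i. (m, i)) ` {..<m} = {}"
    by auto
  ultimately show ?thesis
    using d unfolding border_index_alt by (elim insertE emptyE) (simp_all add: card_Un_disjoint)
qed

lemma entry_last_column:
  assumes "i < m"
  shows "Re (entry d w i m) = w (i, m)" "Im (entry d w i m) = (if d = 1 then 0 else w (m, i))"
  using assms by (simp_all add: entry_def)

lemma sum_border_index:
  "(\<Sum>p\<in>border_index d m. (w p)\<^sup>2) = (\<Sum>i<m. (cmod (entry d w i m))\<^sup>2)"
proof -
  have "(\<Sum>p\<in>border_index d m. (w p)\<^sup>2) =
      (\<Sum>p\<in>(\<lambda>i. (i, m)) ` {..<m}. (w p)\<^sup>2)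
      + (\<Sum>p\<in>(if d = 1 then {} else (\<lambda>i. (m, i)) ` {..<m}). (w p)\<^sup>2)"
    unfolding border_index_alt by (rule sum.union_disjoint) auto
  also have "(\<Sum>p\<in>(\<lambda>i. (i, m)) ` {..<m}. (w p)\<^sup>2) = (\<Sum>i<m. (w (i, m))\<^sup>2)"
    by (subst sum.reindex) (auto simp: inj_on_def)
  also have "(\<Sum>p\<in>(if d = 1 then {} else (\<lambda>i. (m, i)) ` {..<m}). (w p)\<^sup>2)
      = (\<Sum>i<m. (if d = 1 then 0 else w (m, i))\<^sup>2)"
    by (auto simp: sum.reindex inj_on_def)
  finally show ?thesis
    unfolding sum.distrib[symmetric] by (auto simp: cmod_power2 entry_def intro!: sum.cong)
qed

lemma coord_index_Suc:
  "coord_index d (Suc m) = insert (m, m) (border_index d m) \<union> coord_index d m"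
  by (auto simp: coord_index_def border_index_def less_Suc_eq)

lemma sum_schur_shift_diag:
  "(\<Sum>i<m. schur_shift d m w (i, i)) = (\<Sum>p\<in>border_index d m. (w p)\<^sup>2) / w (m, m)"
  unfolding sum_border_index sum_divide_distrib
  by (simp add: schur_shift_def cmod_power2 flip: power2_eq_square)

lemma mat_det_Suc:
  "w (m, m) \<noteq> 0 \<Longrightarrow> mat_det (coord_mat d (Suc m) w) =
     w (m, m) * mat_det (coord_mat d m (\<lambda>p. w p - schur_shift d m w p))"
  by (simp add: mat_det_def det_Suc_schur)

text \<open>The factor that the last row and column contribute to the integrand once the leading block is
  replaced by its Schur complement.\<close>

definition border_weight :: "nat \<Rightarrow> nat \<Rightarrow> real \<Rightarrow> (nat \<times> nat \<Rightarrow> real) \<Rightarrow> real" where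
  "border_weight d m s w = indicator {0<..} (w (m, m)) * w (m, m) powr s * exp (- w (m, m))
     * (\<Prod>p\<in>border_index d m. exp (- (w p)\<^sup>2 / w (m, m)))"

lemma border_weight_nonneg: "0 \<le> border_weight d m s w"
  by (auto simp: border_weight_def intro!: mult_nonneg_nonneg prod_nonneg)

text \<open>The determinant is multiplicative in the Schur decomposition, and the trace of the leading block
  exceeds that of the Schur complement by \<open>\<bar>b\<bar>\<^sup>2/c\<close>, which gives the Gaussian factors.\<close>

lemma cone_weight_Suc:
  "cone_weight d (Suc m) s w =
     border_weight d m s w * cone_weight d m s (\<lambda>p. w p - schur_shift d m w p)"
proof (cases "0 < w (m, m)")
  case True
  have "exp (- mat_tr (coord_mat d (Suc m) w)) =
      exp (- w (m, m)) * (\<Prod>p\<in>border_index d m. exp (- (w p)\<^sup>2 / w (m, m)))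
        * exp (- mat_tr (coord_mat d m (\<lambda>p. w p - schur_shift d m w p)))"
    unfolding exp_sum[OF finite_border_index, symmetric]
    by (simp add: mat_tr_coord_mat exp_add[symmetric] sum_subtractf sum_schur_shift_diag
        sum_negf sum_divide_distrib)
  thus ?thesis
    using True
    by (simp add: cone_weight_def border_weight_def indicator_def pd_cone_Suc_iff mat_det_Suc powr_mult)
next
  case False
  thus ?thesis
    by (simp add: cone_weight_def border_weight_def indicator_def pd_cone_Suc_iff)
qed

lemma borel_measurable_PiM_component:
  "q \<in> K \<Longrightarrow> (\<lambda>w. w q) \<in> borel_measurable (PiM K (\<lambda>_. lborel :: real measure))"
  using measurable_component_singleton[of q K "\<lambda>_. lborel :: real measure"] by simp

lemma schur_shift_measurable:
  assumes p: "p \<in> coord_index d m" and K: "insert (m, m) (border_index d m) \<subseteq> K"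
  shows "(\<lambda>w. schur_shift d m w p) \<in> borel_measurable (PiM K (\<lambda>_. lborel))"
proof -
  obtain i j where ij: "p = (i, j)" "i < m" "j < m"
    using p by (auto simp: coord_index_def)
  have entry: "(\<lambda>w. Re (entry d w l m)) \<in> borel_measurable (PiM K (\<lambda>_. lborel))"
    "(\<lambda>w. Im (entry d w l m)) \<in> borel_measurable (PiM K (\<lambda>_. lborel))" if "l < m" for l
    using that K
    by (cases "d = 1"; auto simp: entry_last_column border_index_def
        intro!: borel_measurable_PiM_component)+
  have "(\<lambda>w. w (m, m)) \<in> borel_measurable (PiM K (\<lambda>_. lborel :: real measure))"
    using K by (intro borel_measurable_PiM_component) auto
  thus ?thesis
    using entry[OF ij(2)] entry[OF ij(3)]
    by (cases "i \<le> j")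
      (simp_all add: schur_shift_def ij borel_measurable_divide borel_measurable_add
        borel_measurable_diff borel_measurable_times)
qed

lemma border_weight_measurable:
  assumes K: "insert (m, m) (border_index d m) \<subseteq> K"
  shows "border_weight d m s \<in> borel_measurable (PiM K (\<lambda>_. lborel))"
proof -
  have last [measurable]: "(\<lambda>w. w (m, m)) \<in> borel_measurable (PiM K (\<lambda>_. lborel :: real measure))"
    using K by (intro borel_measurable_PiM_component) auto
  have "(\<lambda>w. \<Prod>p\<in>border_index d m. exp (- (w p)\<^sup>2 / w (m, m)))
      \<in> borel_measurable (PiM K (\<lambda>_. lborel :: real measure))"
  proof (rule borel_measurable_prod)
    fix p assume "p \<in> border_index d m"
    hence "(\<lambda>w. w p) \<in> borel_measurable (PiM K (\<lambda>_. lborel :: real measure))"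
      using K by (intro borel_measurable_PiM_component) auto
    thus "(\<lambda>w. exp (- (w p)\<^sup>2 / w (m, m))) \<in> borel_measurable (PiM K (\<lambda>_. lborel :: real measure))"
      using last
      by (intro measurable_compose[OF _ borel_measurable_exp] borel_measurable_divide
          borel_measurable_uminus borel_measurable_power)
  qed
  thus ?thesis
    unfolding border_weight_def by measurable
qed

text \<open>The recursion \<open>cone_weight_Suc\<close> also gives measurability, in particular of the cone itself, since
  its shift depends measurably on the coordinates.\<close>

lemma cone_weight_measurable: "cone_weight d m s \<in> borel_measurable (coord_lebesgue d m)"
proof (induction m)
  case 0
  show ?case by (simp add: cone_weight_0[abs_def])
next
  case (Suc m)
  let ?M = "coord_lebesgue d (Suc m)"
  let ?S = "\<lambda>w. \<lambda>p\<in>coord_index d m. w p - schur_shift d m w p"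
  have "?S \<in> measurable ?M (coord_lebesgue d m)"
    unfolding coord_lebesgue_def[of d m]
  proof (rule measurable_restrict)
    fix p assume p: "p \<in> coord_index d m"
    hence "p \<in> coord_index d (Suc m)"
      by (simp add: coord_index_Suc)
    hence [measurable]: "(\<lambda>w. w p) \<in> borel_measurable ?M"
      unfolding coord_lebesgue_def by (rule borel_measurable_PiM_component)
    have "(\<lambda>w. schur_shift d m w p) \<in> borel_measurable ?M"
      unfolding coord_lebesgue_def by (rule schur_shift_measurable[OF p]) (auto simp: coord_index_Suc)
    thus "(\<lambda>w. w p - schur_shift d m w p) \<in> measurable ?M lborel"
      by simp
  qed
  hence "(\<lambda>w. cone_weight d m s (?S w)) \<in> borel_measurable ?M"
    using Suc.IH by (rule measurable_compose)
  moreover have "cone_weight d m s (?S w) = cone_weight d m s (\<lambda>p. w p - schur_shift d m w p)" for w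
    by (rule cone_weight_cong) simp
  moreover have "border_weight d m s \<in> borel_measurable ?M"
    unfolding coord_lebesgue_def by (rule border_weight_measurable) (auto simp: coord_index_Suc)
  ultimately show ?case
    by (subst cone_weight_Suc[abs_def]) (simp add: borel_measurable_times)
qed

text \<open>For fixed \<open>c\<close> each of the \<open>m d\<close> border coordinates contributes a Gaussian integral \<open>sqrt (pi c)\<close>.
  The resulting power of \<open>c\<close> raises the exponent of the remaining Euler integral by \<open>m d/2\<close>.\<close>

lemma nn_integral_border_weight:
  assumes d: "d \<in> {1, 2}" and s: "-1 < s"
  shows "(\<integral>\<^sup>+w. border_weight d m s w \<partial>PiM (insert (m, m) (border_index d m)) (\<lambda>_. lborel))
    = ennreal (sqrt pi ^ (m * d) * Gamma (s + 1 + real m * real d / 2))"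
proof -
  let ?L = "\<lambda>_. lborel :: real measure" and ?K = "border_index d m"
  have notin: "(m, m) \<notin> ?K" by (auto simp: border_index_def)
  have meas: "(\<lambda>w. ennreal (border_weight d m s w)) \<in> borel_measurable (PiM (insert (m, m) ?K) ?L)"
    by (rule measurable_compose[OF border_weight_measurable[OF order_refl] measurable_ennreal])
  have "(\<integral>\<^sup>+w. border_weight d m s w \<partial>PiM (insert (m, m) ?K) ?L)
      = (\<integral>\<^sup>+c. \<integral>\<^sup>+w. border_weight d m s (w((m, m) := c)) \<partial>PiM ?K ?L \<partial>lborel)"
    by (rule lborel_prod.product_nn_integral_insert_rev[OF finite_border_index notin meas])
  also have "\<dots> = (\<integral>\<^sup>+c. ennreal (sqrt pi ^ (m * d))
      * ennreal (indicator {0..} c * c powr (s + 1 + real m * real d / 2 - 1) / exp c) \<partial>lborel)"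
  proof (rule nn_integral_cong)
    fix c :: real
    show "(\<integral>\<^sup>+w. border_weight d m s (w((m, m) := c)) \<partial>PiM ?K ?L) = ennreal (sqrt pi ^ (m * d))
      * ennreal (indicator {0..} c * c powr (s + 1 + real m * real d / 2 - 1) / exp c)"
    proof (cases "0 < c")
      case False
      thus ?thesis by (cases "c = 0") (auto simp: border_weight_def indicator_def)
    next
      case True
      have "(\<integral>\<^sup>+w. border_weight d m s (w((m, m) := c)) \<partial>PiM ?K ?L)
          = (\<integral>\<^sup>+w. ennreal (c powr s * exp (- c)) * (\<Prod>p\<in>?K. ennreal (exp (- (w p)\<^sup>2 / c))) \<partial>PiM ?K ?L)"
      proof (rule nn_integral_cong)
        fix w :: "nat \<times> nat \<Rightarrow> real"
        have "(\<Prod>p\<in>?K. exp (- ((w((m, m) := c)) p)\<^sup>2 / c)) = (\<Prod>p\<in>?K. exp (- (w p)\<^sup>2 / c))"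
          using notin by (intro prod.cong) auto
        thus "ennreal (border_weight d m s (w((m, m) := c)))
            = ennreal (c powr s * exp (- c)) * (\<Prod>p\<in>?K. ennreal (exp (- (w p)\<^sup>2 / c)))"
          using True by (simp add: border_weight_def prod_ennreal ennreal_mult'[symmetric])
      qed
      also have "\<dots> = ennreal (c powr s * exp (- c))
          * (\<integral>\<^sup>+w. (\<Prod>p\<in>?K. ennreal (exp (- (w p)\<^sup>2 / c))) \<partial>PiM ?K ?L)"
      proof (rule nn_integral_cmult)
        show "(\<lambda>w. \<Prod>p\<in>?K. ennreal (exp (- (w p)\<^sup>2 / c))) \<in> borel_measurable (PiM ?K ?L)"
        proof (rule borel_measurable_prod_ennreal)
          fix p assume "p \<in> ?K"
          hence [measurable]: "(\<lambda>w. w p) \<in> borel_measurable (PiM ?K ?L)"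
            by (rule borel_measurable_PiM_component)
          show "(\<lambda>w. ennreal (exp (- (w p)\<^sup>2 / c))) \<in> borel_measurable (PiM ?K ?L)"
            by measurable
        qed
      qed
      also have "(\<integral>\<^sup>+w. (\<Prod>p\<in>?K. ennreal (exp (- (w p)\<^sup>2 / c))) \<partial>PiM ?K ?L)
          = (\<Prod>p\<in>?K. \<integral>\<^sup>+x. ennreal (exp (- x\<^sup>2 / c)) \<partial>lborel)"
        by (rule lborel_prod.product_nn_integral_prod[where f = "\<lambda>_ x. ennreal (exp (- x\<^sup>2 / c))"])
          (auto simp: finite_border_index)
      also have "\<dots> = ennreal (sqrt pi ^ (m * d) * sqrt c ^ (m * d))"
        unfolding nn_integral_gaussian[OF True]
        using True by (simp add: card_border_index[OF d] ennreal_power real_sqrt_mult power_mult_distrib)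
      also have "sqrt c ^ (m * d) = c powr (real m * real d / 2)"
        using True by (simp add: powr_half_sqrt[symmetric] powr_realpow[symmetric] powr_powr)
      also have "ennreal (c powr s * exp (- c)) * ennreal (sqrt pi ^ (m * d) * c powr (real m * real d / 2))
          = ennreal (sqrt pi ^ (m * d) * (indicator {0..} c * c powr (s + 1 + real m * real d / 2 - 1) / exp c))"
      proof -
        have "c powr (s + 1 + real m * real d / 2 - 1) = c powr s * c powr (real m * real d / 2)"
          unfolding powr_add[symmetric] by simp
        moreover have "a * exp (- c) * (b * e) = b * (a * e / exp c)" for a b e :: real
          by (simp add: exp_minus field_simps)
        ultimately show ?thesis
          using True by (subst ennreal_mult[symmetric]) simp_all
      qed
      also have "\<dots> = ennreal (sqrt pi ^ (m * d))
          * ennreal (indicator {0..} c * c powr (s + 1 + real m * real d / 2 - 1) / exp c)"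
        by (rule ennreal_mult) simp_all
      finally show ?thesis .
    qed
  qed
  also have "\<dots> = ennreal (sqrt pi ^ (m * d)) * ennreal (Gamma (s + 1 + real m * real d / 2))"
    using s by (subst Gamma_conv_nn_integral_real) (auto simp: nn_integral_cmult add_pos_nonneg)
  finally show ?thesis
    by (simp add: ennreal_mult'[symmetric])
qed

text \<open>Integrating first over the leading block, with the border fixed, the Schur shift is a constant
  translation and disappears; the inner integral is then independent of the border.\<close>

lemma nn_integral_cone_weight_Suc:
  assumes d: "d \<in> {1, 2}" and s: "-1 < s"
  shows "(\<integral>\<^sup>+w. cone_weight d (Suc m) s w \<partial>coord_lebesgue d (Suc m)) =
    ennreal (sqrt pi ^ (m * d) * Gamma (s + 1 + real m * real d / 2))
      * (\<integral>\<^sup>+w. cone_weight d m s w \<partial>coord_lebesgue d m)"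
proof -
  let ?L = "\<lambda>_. lborel :: real measure" and ?J = "insert (m, m) (border_index d m)"
    and ?I = "coord_index d m"
  have disj: "?J \<inter> ?I = {}" by (auto simp: border_index_def coord_index_def)
  have meas: "(\<lambda>w. ennreal (cone_weight d m s w)) \<in> borel_measurable (PiM ?I ?L)"
    using cone_weight_measurable[of d m s] by (simp add: coord_lebesgue_def)
  have "(\<integral>\<^sup>+w. cone_weight d (Suc m) s w \<partial>coord_lebesgue d (Suc m)) =
      (\<integral>\<^sup>+x. \<integral>\<^sup>+y. cone_weight d (Suc m) s (merge ?J ?I (x, y)) \<partial>PiM ?I ?L \<partial>PiM ?J ?L)"
    using cone_weight_measurable[of d "Suc m" s] unfolding coord_lebesgue_def coord_index_Suc
    by (intro lborel_prod.product_nn_integral_fold disj) (auto simp: finite_border_index finite_coord_index)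
  also have "\<dots> = (\<integral>\<^sup>+x. ennreal (border_weight d m s x)
      * (\<integral>\<^sup>+w. cone_weight d m s w \<partial>coord_lebesgue d m) \<partial>PiM ?J ?L)"
  proof (rule nn_integral_cong)
    fix x :: "nat \<times> nat \<Rightarrow> real"
    have border: "border_weight d m s (merge ?J ?I (x, y)) = border_weight d m s x" for y
      by (simp add: border_weight_def merge_def)
    have "entry d (merge ?J ?I (x, y)) l m = entry d x l m" if "l < m" for l y
      using that by (simp add: complex_eq_iff entry_last_column merge_def border_index_def)
    hence shift: "schur_shift d m (merge ?J ?I (x, y)) p = schur_shift d m x p" if "p \<in> ?I" for y p
      using that by (auto simp: schur_shift_def coord_index_def merge_def)
    have "cone_weight d m s (\<lambda>p. merge ?J ?I (x, y) p - schur_shift d m (merge ?J ?I (x, y)) p)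
        = cone_weight d m s (\<lambda>p\<in>?I. y p + - schur_shift d m x p)" for y
    proof (rule cone_weight_cong)
      fix p assume p: "p \<in> ?I"
      hence "merge ?J ?I (x, y) p = y p"
        using disj by (auto simp: merge_def)
      thus "merge ?J ?I (x, y) p - schur_shift d m (merge ?J ?I (x, y)) p
          = (\<lambda>p\<in>?I. y p + - schur_shift d m x p) p"
        using p by (simp only: shift restrict_apply' diff_conv_add_uminus)
    qed
    hence "(\<integral>\<^sup>+y. cone_weight d (Suc m) s (merge ?J ?I (x, y)) \<partial>PiM ?I ?L)
        = (\<integral>\<^sup>+y. ennreal (border_weight d m s x)
            * ennreal (cone_weight d m s (\<lambda>p\<in>?I. y p + - schur_shift d m x p)) \<partial>PiM ?I ?L)"
      by (simp only: cone_weight_Suc border ennreal_mult[OF border_weight_nonneg cone_weight_nonneg])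
    also have "\<dots> = ennreal (border_weight d m s x)
        * (\<integral>\<^sup>+y. ennreal (cone_weight d m s (\<lambda>p\<in>?I. y p + - schur_shift d m x p)) \<partial>PiM ?I ?L)"
      by (intro nn_integral_cmult measurable_compose[OF _ meas]) measurable
    also have "(\<integral>\<^sup>+y. ennreal (cone_weight d m s (\<lambda>p\<in>?I. y p + - schur_shift d m x p)) \<partial>PiM ?I ?L)
        = (\<integral>\<^sup>+w. cone_weight d m s w \<partial>coord_lebesgue d m)"
      unfolding coord_lebesgue_def
      by (rule nn_integral_PiM_lborel_translate[OF finite_coord_index meas])
    finally show "(\<integral>\<^sup>+y. cone_weight d (Suc m) s (merge ?J ?I (x, y)) \<partial>PiM ?I ?L)
        = ennreal (border_weight d m s x) * (\<integral>\<^sup>+w. cone_weight d m s w \<partial>coord_lebesgue d m)" .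
  qed
  also have "\<dots> = (\<integral>\<^sup>+x. border_weight d m s x \<partial>PiM ?J ?L)
      * (\<integral>\<^sup>+w. cone_weight d m s w \<partial>coord_lebesgue d m)"
    by (intro nn_integral_multc measurable_compose[OF border_weight_measurable[OF order_refl] measurable_ennreal])
  finally show ?thesis
    by (simp add: nn_integral_border_weight[OF d s])
qed

lemma nn_integral_cone_weight:
  assumes "d \<in> {1, 2}" and "-1 < s"
  shows "(\<integral>\<^sup>+w. cone_weight d m s w \<partial>coord_lebesgue d m) =
    ennreal (\<Prod>i<m. sqrt pi ^ (i * d) * Gamma (s + 1 + real i * real d / 2))"
proof (induction m)
  case 0
  interpret P: prob_space "PiM {} (\<lambda>_::nat \<times> nat. lborel :: real measure)"
    by (rule prob_spaceI) (simp add: space_PiM emeasure_PiM_empty)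
  show ?case
    using P.emeasure_space_1 by (simp add: cone_weight_0 coord_lebesgue_def coord_index_def)
next
  case (Suc m)
  have "0 \<le> (\<Prod>i<m. sqrt pi ^ (i * d) * Gamma (s + 1 + real i * real d / 2))"
    using assms(2) by (intro prod_nonneg ballI mult_nonneg_nonneg less_imp_le[OF Gamma_real_pos])
      (auto simp: add_pos_nonneg)
  thus ?case
    unfolding nn_integral_cone_weight_Suc[OF assms] Suc.IH
    by (simp add: ennreal_mult''[symmetric] mult_ac)
qed

text \<open>Here \<open>s + 1 = \<mu> - (m - 1) d/2\<close>, so that the factors of \<open>nn_integral_cone_weight\<close> are the
  \<open>\<Gamma>(\<mu> - j d/2)\<close> listed in the opposite order \<open>j = m - 1 - i\<close>.\<close>

lemma cone_Gamma_eq_prod_Gamma: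
  assumes d: "d \<in> {1, 2}" and \<mu>: "(real m - 1) * real d / 2 < \<mu>"
  shows "cone_Gamma d m \<mu> =
    (\<Prod>i<m. sqrt pi ^ (i * d)) * (\<Prod>j<m. Gamma (\<mu> - real j * real d / 2))"
proof -
  let ?s = "\<mu> - (real m - 1) / 2 * real d - 1"
  let ?P = "\<Prod>i<m. sqrt pi ^ (i * d) * Gamma (?s + 1 + real i * real d / 2)"
  have s: "-1 < ?s" using \<mu> by simp
  have "cone_Gamma d m \<mu> = integral\<^sup>L (coord_lebesgue d m) (cone_weight d m ?s)"
    by (simp add: cone_Gamma_def set_lebesgue_integral_def cone_weight_def[abs_def])
  also have "\<dots> = enn2real (\<integral>\<^sup>+w. cone_weight d m ?s w \<partial>coord_lebesgue d m)"
    by (intro integral_eq_nn_integral cone_weight_measurable AE_I2 cone_weight_nonneg)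
  also have "\<dots> = ?P"
    unfolding nn_integral_cone_weight[OF d s] using s
    by (intro enn2real_ennreal prod_nonneg ballI mult_nonneg_nonneg less_imp_le[OF Gamma_real_pos])
      (auto simp: add_pos_nonneg)
  also have "\<dots> = (\<Prod>i<m. sqrt pi ^ (i * d)) * (\<Prod>i<m. Gamma (?s + 1 + real i * real d / 2))"
    by (rule prod.distrib)
  also have "(\<Prod>i<m. Gamma (?s + 1 + real i * real d / 2)) = (\<Prod>j<m. Gamma (\<mu> - real j * real d / 2))"
    by (subst prod.nat_diff_reindex[symmetric], intro prod.cong refl arg_cong[of _ _ Gamma])
      (auto simp: of_nat_diff field_simps)
  finally show ?thesis .
qed

section \<open>Logarithmic derivatives\<close>

text \<open>The value of \<^const>\<open>cone_psi\<close> on the domain of convergence, by the product formula.\<close>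

definition psi_sum :: "nat \<Rightarrow> nat \<Rightarrow> real \<Rightarrow> real" where
  "psi_sum d m x = (\<Sum>j<m. Digamma (x - real j * real d / 2))"

lemma arguments_pos:
  assumes "(real m - 1) * real d / 2 < x" "j < m"
  shows "0 < x - real j * real d / 2"
proof -
  have "real j * real d / 2 \<le> (real m - 1) * real d / 2"
    using assms(2) by (intro divide_right_mono mult_right_mono) auto
  thus ?thesis using assms(1) by simp
qed

lemma has_derivative_ln_cone_Gamma:
  assumes d: "d \<in> {1, 2}" and x: "(real m - 1) * real d / 2 < x"
  shows "((\<lambda>s. ln (cone_Gamma d m s)) has_real_derivative psi_sum d m x) (at x)"
proof -
  let ?C = "\<Prod>i<m. sqrt pi ^ (i * d)" and ?D = "{(real m - 1) * real d / 2<..}"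
  let ?f = "\<lambda>s. ln ?C + (\<Sum>j<m. ln_Gamma (s - real j * real d / 2))"
  have eq: "?f s = ln (cone_Gamma d m s)" if s: "s \<in> ?D" for s
  proof -
    have pos: "0 < Gamma (s - real j * real d / 2)" if "j < m" for j
      using arguments_pos[OF _ that] s by simp
    hence "Gamma (s - real j * real d / 2) \<noteq> 0" if "j < m" for j
      using that by force
    moreover have "ln (Gamma (s - real j * real d / 2)) = ln_Gamma (s - real j * real d / 2)" if "j < m" for j
      using arguments_pos[OF _ that] s by (simp add: ln_Gamma_real_pos)
    ultimately have ln_prod_Gamma:
      "ln (\<Prod>j<m. Gamma (s - real j * real d / 2)) = (\<Sum>j<m. ln_Gamma (s - real j * real d / 2))"
      by (subst ln_prod) auto
    have "0 < ?C" by (intro prod_pos) simp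
    moreover have "0 < (\<Prod>j<m. Gamma (s - real j * real d / 2))"
      using pos by (intro prod_pos) simp
    moreover have "cone_Gamma d m s = ?C * (\<Prod>j<m. Gamma (s - real j * real d / 2))"
      using s by (intro cone_Gamma_eq_prod_Gamma d) simp
    ultimately show ?thesis
      by (simp only: ln_mult_pos ln_prod_Gamma)
  qed
  have "(?f has_real_derivative psi_sum d m x) (at x)"
    using arguments_pos[OF x] unfolding psi_sum_def
    by (auto intro!: derivative_eq_intros)
  thus ?thesis
    by (rule has_field_derivative_transform_within_open[where S = ?D]) (use x eq in auto)
qed

lemma cone_psi_eq:
  assumes "d \<in> {1, 2}" and "(real m - 1) * real d / 2 < x"
  shows "cone_psi d m x = psi_sum d m x"
  unfolding cone_psi_def by (rule DERIV_imp_deriv[OF has_derivative_ln_cone_Gamma[OF assms]])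

text \<open>The shift by \<open>q d/2\<close> found here is what determines the position of the minimum of the risk.\<close>

lemma psi_sum_add: "psi_sum d (q + m) x = psi_sum d q x + psi_sum d m (x - real q * real d / 2)"
proof (induction m)
  case (Suc m)
  have eq: "x - real (q + m) * real d / 2 = x - real q * real d / 2 - real m * real d / 2"
    by (simp add: algebra_simps add_divide_distrib)
  show ?case
    using Suc.IH unfolding psi_sum_def add_Suc_right sum.lessThan_Suc eq by simp
qed (simp add: psi_sum_def)

text \<open>The difference has derivative \<open>\<psi>'(z) - \<psi>'(z + \<nu>)\<close>, and the trigamma function \<open>\<psi>'\<close> decreases.\<close>

lemma Digamma_diff_mono:
  assumes "0 < x" "x \<le> y" "0 \<le> \<nu>"
  shows "Digamma x - Digamma (x + \<nu>) \<le> Digamma y - Digamma (y + (\<nu>::real))"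
proof (rule DERIV_nonneg_imp_nondecreasing[OF assms(2)])
  fix z assume "x \<le> z" "z \<le> y"
  hence z: "0 < z" using assms(1) by simp
  hence "((\<lambda>z. Digamma z - Digamma (z + \<nu>)) has_real_derivative Polygamma 1 z - Polygamma 1 (z + \<nu>)) (at z)"
    using assms(3) by (auto intro!: derivative_eq_intros simp: nonpos_Ints_def)
  moreover have "Polygamma 1 (z + \<nu>) \<le> Polygamma 1 z"
    using z assms(3) Polygamma_real_strict_antimono[of z "z + \<nu>" 1] by (cases "\<nu> = 0") auto
  ultimately show "\<exists>D. ((\<lambda>z. Digamma z - Digamma (z + \<nu>)) has_real_derivative D) (at z) \<and> 0 \<le> D"
    by (intro exI conjI) auto
qed

lemma psi_sum_diff_mono:
  assumes "(real m - 1) * real d / 2 < x" "x \<le> y" "0 \<le> \<nu>"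
  shows "psi_sum d m x - psi_sum d m (x + \<nu>) \<le> psi_sum d m y - psi_sum d m (y + \<nu>)"
  unfolding psi_sum_def sum_subtractf[symmetric]
proof (rule sum_mono)
  fix j assume "j \<in> {..<m}"
  thus "Digamma (x - real j * real d / 2) - Digamma (x + \<nu> - real j * real d / 2)
      \<le> Digamma (y - real j * real d / 2) - Digamma (y + \<nu> - real j * real d / 2)"
    using Digamma_diff_mono[OF arguments_pos[OF assms(1)], of j "y - real j * real d / 2" \<nu>] assms
    by (simp add: algebra_simps)
qed

lemma convex_on_above_stationary:
  fixes f :: "real \<Rightarrow> real"
  assumes "convex_on {a<..} f" "(f has_real_derivative 0) (at x)" "a < x" "a < y"
  shows "f x \<le> f y"
proof -
  have "x \<in> interior {a<..}" using assms(3) by (simp add: interior_open)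
  moreover have "(f has_real_derivative 0) (at x within {a<..})"
    using assms(2) by (rule has_field_derivative_at_within)
  ultimately have "0 * (y - x) \<le> f y - f x"
    using assms(1,4) by (intro convex_on_imp_above_tangent[where A = "{a<..}"]) auto
  thus ?thesis by simp
qed

section \<open>The risk of one block and the total risk\<close>

lemma r_upto_eq: "r_upto k i = r_below k i + k i"
proof -
  have "{..i} = insert i {..<i}" by auto
  thus ?thesis by (simp add: r_upto_def r_below_def)
qed

lemma herm_dim_div: "0 < m \<Longrightarrow> herm_dim d m / real m = 1 + (real m - 1) * real d / 2"
  by (simp add: herm_dim_def field_simps)

text \<open>The lower end \<open>lo\<close> of the domain corresponds to \<open>x = (m - 1) d/2\<close>, the end of the domain of
  \<open>\<Gamma>\<^sub>m\<close>. The derivative \<open>f'\<close> increases by \<open>psi_sum_diff_mono\<close>, and at \<open>t_R\<close>, where \<open>x = \<mu> - q d/2\<close>,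
  its constant part \<open>D\<close> cancels the rest.\<close>

lemma risk_part_convex_and_minimal:
  fixes d :: nat and k :: "'h::{finite,linorder} \<Rightarrow> nat" and i :: 'h and \<mu> \<nu> s :: real
  defines "lo \<equiv> - \<mu> - (real (r_upto k i) - real (k i)) / 2 * real d - 1"
  assumes d: "d \<in> {1, 2}" and k: "\<And>i. k i > 0"
    and \<mu>: "(real (r_upto k i) - 1) * real d / 2 < \<mu>" and \<nu>: "0 \<le> \<nu>"
  shows "convex_on {lo<..} (risk_part d k \<mu> \<nu> i)"
    and "t_R d k $ i \<in> {lo<..}"
    and "s \<in> {lo<..} \<Longrightarrow> risk_part d k \<mu> \<nu> i (t_R d k $ i) \<le> risk_part d k \<mu> \<nu> i s"
proof -
  define r q m where "r = r_upto k i" and "q = r_below k i" and "m = k i"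
  define x where "x s = s + \<mu> + herm_dim d r / real r" for s
  let ?b = "herm_dim d q / real q"
  have r: "r = q + m" and m: "0 < m"
    using k by (simp_all add: r_def q_def m_def r_upto_eq)
  hence x: "x s = s + \<mu> + 1 + (real r - 1) * real d / 2" for s
    using herm_dim_div[of r d] by (simp add: x_def)
  have x_iff: "(real m - 1) * real d / 2 < x s \<longleftrightarrow> s \<in> {lo<..}" for s
    by (simp add: x lo_def r_def[symmetric] m_def[symmetric]) (auto simp: r field_simps)
  have t_R: "x (t_R d k $ i) = \<mu> - real q * real d / 2"
    by (simp add: x t_R_def r_def[symmetric] m_def[symmetric]) (simp add: r field_simps)
  define D where "D = psi_sum d m (\<mu> + \<nu> - real q * real d / 2) - psi_sum d m (\<mu> - real q * real d / 2)"
  define f' where "f' s = psi_sum d m (x s) - psi_sum d m (x s + \<nu>) + D" for s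
  have q_le: "(real q - 1) * real d / 2 < \<mu>"
  proof -
    have "(real q - 1) * real d / 2 \<le> (real r - 1) * real d / 2"
      by (intro divide_right_mono mult_right_mono) (auto simp: r)
    thus ?thesis using \<mu> by (simp add: r_def)
  qed
  have psi: "cone_psi d r \<mu> = psi_sum d r \<mu>" "cone_psi d r (\<mu> + \<nu>) = psi_sum d r (\<mu> + \<nu>)"
    "cone_psi d q \<mu> = psi_sum d q \<mu>" "cone_psi d q (\<mu> + \<nu>) = psi_sum d q (\<mu> + \<nu>)"
    using \<mu> \<nu> q_le by (auto intro!: cone_psi_eq[OF d] simp: r_def[symmetric])
  \<comment> \<open>in the first block \<open>q = 0\<close>, so the missing terms in \<open>q\<close> may be written with the empty sum\<close>
  have empty: "psi_sum d q y = 0" if "{..<i} = {}" for y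
    using that by (simp add: q_def r_below_def psi_sum_def)
  have deriv: "(risk_part d k \<mu> \<nu> i has_real_derivative f' s) (at s)" if s: "s \<in> {lo<..}" for s
  proof -
    have pos: "(real m - 1) * real d / 2 < x s" "(real m - 1) * real d / 2 < x s + \<nu>"
      using s x_iff[of s] \<nu> by linarith+
    have G: "((\<lambda>s. ln (cone_Gamma d m (x s + e))) has_real_derivative psi_sum d m (x s + e)) (at s)"
      if "(real m - 1) * real d / 2 < x s + e" for e
    proof -
      have "((\<lambda>s. x s + e) has_real_derivative 1) (at s)"
        unfolding x_def by (auto intro!: derivative_eq_intros)
      from DERIV_chain2[where f = "\<lambda>s. ln (cone_Gamma d m s)" and g = "\<lambda>s. x s + e",
          OF has_derivative_ln_cone_Gamma[OF d that] this]
      show ?thesis by simp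
    qed
    let ?lin = "\<lambda>s. - \<nu> * real m + (x s + \<nu>) * psi_sum d r (\<mu> + \<nu>) - x s * psi_sum d r \<mu>
      + (if {..<i} = {} then 0
         else - (s + \<mu> + \<nu> + ?b) * psi_sum d q (\<mu> + \<nu>) + (s + \<mu> + ?b) * psi_sum d q \<mu>)"
    have lin: "(?lin has_real_derivative
        psi_sum d r (\<mu> + \<nu>) - psi_sum d r \<mu> - psi_sum d q (\<mu> + \<nu>) + psi_sum d q \<mu>) (at s)"
      unfolding x_def by (cases "{..<i} = {}") (auto intro!: derivative_eq_intros simp: empty)
    have "((\<lambda>s. - ln (cone_Gamma d m (x s + \<nu>)) + ln (cone_Gamma d m (x s + 0)) + ?lin s)
      has_real_derivative f' s) (at s)"
    proof (rule DERIV_cong[OF DERIV_add[OF DERIV_add[OF DERIV_minus[OF G] G] lin]])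
      have "psi_sum d r y = psi_sum d q y + psi_sum d m (y - real q * real d / 2)" for y
        unfolding r by (rule psi_sum_add)
      thus "- psi_sum d m (x s + \<nu>) + psi_sum d m (x s + 0) + (psi_sum d r (\<mu> + \<nu>) - psi_sum d r \<mu>
          - psi_sum d q (\<mu> + \<nu>) + psi_sum d q \<mu>) = f' s"
        by (simp add: f'_def D_def)
    qed (use pos in simp_all)
    moreover have "risk_part d k \<mu> \<nu> i
        = (\<lambda>s. - ln (cone_Gamma d m (x s + \<nu>)) + ln (cone_Gamma d m (x s + 0)) + ?lin s)"
      by (rule ext) (simp add: risk_part_def Let_def r_def[symmetric] q_def[symmetric] m_def[symmetric] psi x_def
          add_ac)
    ultimately show ?thesis
      by (simp only:)
  qed
  show convex: "convex_on {lo<..} (risk_part d k \<mu> \<nu> i)"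
  proof (rule convex_on_realI[OF _ deriv])
    fix s t assume "s \<in> {lo<..}" "t \<in> {lo<..}" "s \<le> t"
    thus "f' s \<le> f' t"
      using psi_sum_diff_mono[of m d "x s" "x t" \<nu>] x_iff[of s] \<nu> by (simp add: f'_def x_def)
  qed simp_all
  show t_R_mem: "t_R d k $ i \<in> {lo<..}"
    unfolding x_iff[symmetric] t_R using \<mu> by (simp add: r_def[symmetric]) (simp add: r field_simps)
  have "f' (t_R d k $ i) = 0"
    by (simp add: f'_def t_R D_def algebra_simps)
  thus "s \<in> {lo<..} \<Longrightarrow> risk_part d k \<mu> \<nu> i (t_R d k $ i) \<le> risk_part d k \<mu> \<nu> i s"
    using convex_on_above_stationary[OF convex] deriv[OF t_R_mem] t_R_mem by auto
qed

lemma convex_on_sum_coordinates: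
  fixes f :: "'h::finite \<Rightarrow> real \<Rightarrow> real"
  assumes "\<And>i. convex_on {lo i<..} (f i)"
  shows "convex_on {t::real^'h. \<forall>i. t $ i > lo i} (\<lambda>t. \<Sum>i\<in>UNIV. f i (t $ i))"
proof (rule convex_onI)
  have "convex {t::real^'h. \<forall>i. t $ i > lo i}"
    unfolding convex_alt
  proof (intro ballI allI impI, clarsimp)
    fix t t' :: "real^'h" and u :: real and i :: 'h
    assume "\<forall>i. lo i < t $ i" "\<forall>i. lo i < t' $ i" "0 \<le> u" "u \<le> 1"
    thus "lo i < (1 - u) * t $ i + u * t' $ i"
      using convexD_alt[OF convex_real_interval(3)[of "lo i"], of "t $ i" "t' $ i" u] by simp
  qed
  thus "convex {t::real^'h. \<forall>i. t $ i > lo i}" .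
next
  fix u :: real and t t' :: "real^'h"
  assume "0 < u" "u < 1" "t \<in> {t. \<forall>i. lo i < t $ i}" "t' \<in> {t. \<forall>i. lo i < t $ i}"
  hence "f i ((1 - u) * t $ i + u * t' $ i) \<le> (1 - u) * f i (t $ i) + u * f i (t' $ i)" for i
    using convex_onD[OF assms[of i], of u "t $ i" "t' $ i"] by simp
  hence "(\<Sum>i\<in>UNIV. f i ((1 - u) * t $ i + u * t' $ i))
      \<le> (\<Sum>i\<in>UNIV. (1 - u) * f i (t $ i) + u * f i (t' $ i))"
    by (intro sum_mono)
  thus "(\<Sum>i\<in>UNIV. f i (((1 - u) *\<^sub>R t + u *\<^sub>R t') $ i))
      \<le> (1 - u) * (\<Sum>i\<in>UNIV. f i (t $ i)) + u * (\<Sum>i\<in>UNIV. f i (t' $ i))"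
    by (simp add: sum.distrib sum_distrib_left)
qed

theorem theorem2:
  fixes d r :: nat and k :: "'h::{finite,linorder} \<Rightarrow> nat" and \<mu> \<nu> :: real
  assumes "d \<in> {1, 2}"
    and "CARD('h) \<ge> 2"
    and "\<And>i. k i > 0"
    and "(\<Sum>i\<in>UNIV. k i) = r"
    and "\<mu> > (real r - 1) * real d / 2"
    and "\<nu> > (real r - 1) * real d / 2"
  shows "convex_on (risk_domain d k \<mu>) (risk d k \<mu> \<nu>)
       \<and> t_R d k \<in> risk_domain d k \<mu>
       \<and> (\<forall>t \<in> risk_domain d k \<mu>. risk d k \<mu> \<nu> (t_R d k) \<le> risk d k \<mu> \<nu> t)"
proof -
  have le: "r_upto k i \<le> r" for i
    unfolding r_upto_def assms(4)[symmetric] by (rule sum_mono2) auto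
  have \<mu>: "(real (r_upto k i) - 1) * real d / 2 < \<mu>" for i
  proof -
    have "(real (r_upto k i) - 1) * real d / 2 \<le> (real r - 1) * real d / 2"
      using le[of i] by (intro divide_right_mono mult_right_mono) auto
    thus ?thesis using assms(5) by simp
  qed
  obtain i :: 'h where True by simp
  have "1 \<le> r" using le[of i] assms(3)[of i] by (simp add: r_upto_eq)
  hence "0 \<le> (real r - 1) * real d / 2" by simp
  hence \<nu>: "0 \<le> \<nu>" using assms(6) by linarith
  note part = risk_part_convex_and_minimal[OF assms(1,3) \<mu> \<nu>]
  have "convex_on (risk_domain d k \<mu>) (risk d k \<mu> \<nu>)"
    unfolding risk_domain_def risk_def[abs_def] using part(1) by (rule convex_on_sum_coordinates)
  moreover have "t_R d k \<in> risk_domain d k \<mu>"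
    using part(2) by (simp add: risk_domain_def)
  moreover have "risk d k \<mu> \<nu> (t_R d k) \<le> risk d k \<mu> \<nu> t" if "t \<in> risk_domain d k \<mu>" for t
    using that part(3) unfolding risk_def by (intro sum_mono) (simp add: risk_domain_def)
  ultimately show ?thesis by blast
qed

end
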